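(* Let $I$ be a GBP instance, $\varepsilon\in(0,1)$ a constant, with $k$, small/medium/large items, small/large groups and $OPT=OPT(I)>\frac{3}{\varepsilon^{k+2}}$ as in the context, and consider the rounded instance obtained as described in the context. Let $\zeta$ be an assignment of slot patterns to $OPT$ bins which corresponds to an optimal solution. Then, starting from the packing of the (remaining, rounded) large and medium items of large groups and large items of small groups according to $\zeta$, the algorithm Swapping resolves all conflicts in polynomial time; i.e., it terminates after polynomially many steps with a packing of these items in the $OPT$ bins in which no bin contains two items of the same group and bin capacities are respected.
   Context: GBP: an instance $I$ is a set of $N$ items with sizes $s_\ell\in(0,1]$, partitioned into groups $G_1,\dots,G_n$. A packing into unit-size bins is feasible if the total size in each bin is at most $1$ and no two items of the same group share a bin (two such items in the same bin are in conflict). $OPT=OPT(I)$ is the minimum number of bins in a feasible packing of $I$. Classification: $k\in\{1,\dots,\lceil 1/\varepsilon^2\rceil\}$ is an integer with $\sum_{\ell: s_\ell\in[\varepsilon^{k+1},\varepsilon^k)}s_\ell\le\varepsilon^2\cdot OPT$. Item $\ell$ is small if $s_\ell<\varepsilon^{k+1}$, medium if $s_\ell\in[\varepsilon^{k+1},\varepsilon^k)$, large otherwise. A group is large if it contains at least $\varepsilon^{k+2}\cdot OPT$ large and medium items, and small otherwise. It is assumed that $OPT>3/\varepsilon^{k+2}$. Linear shifting of a set of items with parameter $Q$: sort the items in non-increasing order of size, partition them consecutively into classes of $\max\{Q,1\}$ items each (except possibly the last); discard class 1 (the largest items); round up the size of every item in each remaining class to the maximum size of an item in its class. Rounded instance: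 for each large group separately, linear shifting with $Q=\lfloor\varepsilon^{2k+4}\cdot OPT\rfloor$ is applied to its large and medium items. All large items of all small groups together are merged into one set, to which linear shifting with $Q=\lfloor 2\varepsilon\cdot OPT\rfloor$ is applied; in addition to class 1, the last size class of this set is discarded too. Slots and patterns: let $G_{i_1},\dots,G_{i_L}$ be the large groups and $u$ a label representing all small groups. A slot is a pair $(s,j)$ where $s$ is the rounded size of a large or medium item and $j\in\{i_1,\dots,i_L\}\cup\{u\}$. A pattern is a multiset of at most $\lfloor 1/\varepsilon^{k+1}\rfloor$ slots. An assignment $\zeta$ of a pattern to each of $OPT$ bins corresponds to an optimal solution if there is a packing of the rounded instance in $OPT$ bins, respecting bin capacities and in which the only conflicts allowed are those involving a large item of a small group, such that in every bin the large and medium items of large groups (each contributing the slot given by its rounded size and its group) and the large items of small groups (each contributing the slot given by its rounded size and the label $u$) form exactly the pattern that $\zeta$ assigns to that bin. Swaps: for an item $\ell$ that conflicts with another item in bin $b$, and an item $y$ in bin $c$ with $s_y=s_\ell$ (rounded sizes), $swap(\ell,y)$ exchanges the positions of $\ell$ and $y$. It is bad if $y$ conflicts with an item in bin $b$, or $\ell$ conflicts with an item in bin $c$, or $c=b$; otherwise it is good. Algorithm Swapping: (1) pack the large and medium items of large groups in slots matching their sizes and group labels; (2) pack the large items of small groups arbitrarily in slots $(s,u)$ matching their sizes, ignoring group constraints; (3) while there is an item $\ell$ involved in a conflict, find a good $swap(\ell,y)$ and perform it. *)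

theory Defs
  imports Complex_Main "HOL-Library.Multiset" "HOL-Computational_Algebra.Polynomial"
begin

section \<open>Group bin packing\<close>

text \<open>Items are \<open>1, \<dots>, N\<close>; the partition into groups \<open>G\<^sub>1, \<dots>, G\<^sub>n\<close> is given by the function
  sending an item to the index of its group.\<close>

record gbp =
  nitems :: nat
  ngroups :: nat
  isize :: "nat \<Rightarrow> real"
  grp :: "nat \<Rightarrow> nat"

definition items :: "gbp \<Rightarrow> nat set" where
  "items I = {1..nitems I}"

definition gbp_instance :: "gbp \<Rightarrow> bool" where
  "gbp_instance I \<longleftrightarrow>
     (\<forall>l\<in>items I. 0 < isize I l \<and> isize I l \<le> 1) \<and> grp I ` items I = {1..ngroups I}"

text \<open>A packing of a set \<open>A\<close> of items into the bins \<open>1, \<dots>, m\<close> maps every item to its bin.  The set,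
  the sizes \<open>s\<close> and the groups \<open>g\<close> are parameters, because the same notions are needed for the
  original and for the rounded instance.\<close>

definition packs_within_capacity :: "nat set \<Rightarrow> (nat \<Rightarrow> real) \<Rightarrow> nat \<Rightarrow> (nat \<Rightarrow> nat) \<Rightarrow> bool" where
  "packs_within_capacity A s m P \<longleftrightarrow>
     (\<forall>l\<in>A. P l \<in> {1..m}) \<and> (\<forall>b\<in>{1..m}. (\<Sum>l | l \<in> A \<and> P l = b. s l) \<le> 1)"

definition conflict :: "(nat \<Rightarrow> nat) \<Rightarrow> (nat \<Rightarrow> nat) \<Rightarrow> nat \<Rightarrow> nat \<Rightarrow> bool" where
  "conflict g P l z \<longleftrightarrow> l \<noteq> z \<and> P l = P z \<and> g l = g z"

definition feasible_packing ::
    "nat set \<Rightarrow> (nat \<Rightarrow> real) \<Rightarrow> (nat \<Rightarrow> nat) \<Rightarrow> nat \<Rightarrow> (nat \<Rightarrow> nat) \<Rightarrow> bool" where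
  "feasible_packing A s g m P \<longleftrightarrow>
     packs_within_capacity A s m P \<and> (\<forall>l\<in>A. \<forall>z\<in>A. \<not> conflict g P l z)"

definition OPT :: "gbp \<Rightarrow> nat" where
  "OPT I = (LEAST m. \<exists>P. feasible_packing (items I) (isize I) (grp I) m P)"


section \<open>Classification of items and groups\<close>

definition small_item :: "real \<Rightarrow> nat \<Rightarrow> gbp \<Rightarrow> nat \<Rightarrow> bool" where
  "small_item \<epsilon> k I l \<longleftrightarrow> isize I l < \<epsilon> ^ (k + 1)"

definition medium_item :: "real \<Rightarrow> nat \<Rightarrow> gbp \<Rightarrow> nat \<Rightarrow> bool" where
  "medium_item \<epsilon> k I l \<longleftrightarrow> \<epsilon> ^ (k + 1) \<le> isize I l \<and> isize I l < \<epsilon> ^ k"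

definition large_item :: "real \<Rightarrow> nat \<Rightarrow> gbp \<Rightarrow> nat \<Rightarrow> bool" where
  "large_item \<epsilon> k I l \<longleftrightarrow> \<not> small_item \<epsilon> k I l \<and> \<not> medium_item \<epsilon> k I l"

definition large_or_medium :: "real \<Rightarrow> nat \<Rightarrow> gbp \<Rightarrow> nat \<Rightarrow> bool" where
  "large_or_medium \<epsilon> k I l \<longleftrightarrow> large_item \<epsilon> k I l \<or> medium_item \<epsilon> k I l"

definition admissible_k :: "real \<Rightarrow> gbp \<Rightarrow> nat \<Rightarrow> bool" where
  "admissible_k \<epsilon> I k \<longleftrightarrow>
     k \<in> {1..nat \<lceil>1 / \<epsilon>\<^sup>2\<rceil>} \<and>
     (\<Sum>l | l \<in> items I \<and> medium_item \<epsilon> k I l. isize I l) \<le> \<epsilon>\<^sup>2 * real (OPT I)"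

definition large_group :: "real \<Rightarrow> nat \<Rightarrow> gbp \<Rightarrow> nat \<Rightarrow> bool" where
  "large_group \<epsilon> k I j \<longleftrightarrow>
     j \<in> {1..ngroups I} \<and>
     real (card {l \<in> items I. grp I l = j \<and> large_or_medium \<epsilon> k I l})
       \<ge> \<epsilon> ^ (k + 2) * real (OPT I)"

definition small_group :: "real \<Rightarrow> nat \<Rightarrow> gbp \<Rightarrow> nat \<Rightarrow> bool" where
  "small_group \<epsilon> k I j \<longleftrightarrow> j \<in> {1..ngroups I} \<and> \<not> large_group \<epsilon> k I j"


section \<open>Linear shifting and the rounded instance\<close>

text \<open>\<open>xs\<close> lists the shifted items in non-increasing order of size, ties being broken arbitrarily.
  Size classes are numbered from \<open>0\<close>, so class \<open>0\<close> holds the largest items.\<close>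

definition sorted_enum :: "(nat \<Rightarrow> real) \<Rightarrow> nat set \<Rightarrow> nat list \<Rightarrow> bool" where
  "sorted_enum s A xs \<longleftrightarrow> distinct xs \<and> set xs = A \<and> sorted_wrt (\<lambda>x y. s x \<ge> s y) xs"

definition size_class :: "nat \<Rightarrow> nat list \<Rightarrow> nat \<Rightarrow> nat set" where
  "size_class Q xs c = set (take (max Q 1) (drop (c * max Q 1) xs))"

definition last_class :: "nat \<Rightarrow> nat list \<Rightarrow> nat" where
  "last_class Q xs = (length xs - 1) div max Q 1"

definition shifted_size :: "(nat \<Rightarrow> real) \<Rightarrow> nat \<Rightarrow> nat list \<Rightarrow> nat \<Rightarrow> real" where
  "shifted_size s Q xs l = Max {s y | y c. l \<in> size_class Q xs c \<and> y \<in> size_class Q xs c}"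

text \<open>\<open>Small_Groups\<close> is the label \<open>u\<close> that represents all small groups.\<close>

datatype label = Large_Group nat | Small_Groups

definition label_of :: "real \<Rightarrow> nat \<Rightarrow> gbp \<Rightarrow> nat \<Rightarrow> label" where
  "label_of \<epsilon> k I l =
     (if large_group \<epsilon> k I (grp I l) then Large_Group (grp I l) else Small_Groups)"

definition labels :: "real \<Rightarrow> nat \<Rightarrow> gbp \<Rightarrow> label set" where
  "labels \<epsilon> k I = insert Small_Groups (Large_Group ` {j. large_group \<epsilon> k I j})"

text \<open>Each label stands for one application of linear shifting: to the set \<open>shift_set\<close>, with the
  parameter \<open>shift_param\<close>.\<close>

fun shift_set :: "real \<Rightarrow> nat \<Rightarrow> gbp \<Rightarrow> label \<Rightarrow> nat set" where
  "shift_set \<epsilon> k I (Large_Group j) = {l \<in> items I. grp I l = j \<and> large_or_medium \<epsilon> k I l}"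
| "shift_set \<epsilon> k I Small_Groups = {l \<in> items I. small_group \<epsilon> k I (grp I l) \<and> large_item \<epsilon> k I l}"

fun shift_param :: "real \<Rightarrow> nat \<Rightarrow> gbp \<Rightarrow> label \<Rightarrow> nat" where
  "shift_param \<epsilon> k I (Large_Group j) = nat \<lfloor>\<epsilon> ^ (2 * k + 4) * real (OPT I)\<rfloor>"
| "shift_param \<epsilon> k I Small_Groups = nat \<lfloor>2 * \<epsilon> * real (OPT I)\<rfloor>"

text \<open>The rounded instance depends on how ties are broken when sorting; \<open>ord\<close> records the sorted
  list used for every label.\<close>

definition shift_orders :: "real \<Rightarrow> nat \<Rightarrow> gbp \<Rightarrow> (label \<Rightarrow> nat list) \<Rightarrow> bool" where
  "shift_orders \<epsilon> k I ord \<longleftrightarrow>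
     (\<forall>a\<in>labels \<epsilon> k I. sorted_enum (isize I) (shift_set \<epsilon> k I a) (ord a))"

fun discarded :: "real \<Rightarrow> nat \<Rightarrow> gbp \<Rightarrow> (label \<Rightarrow> nat list) \<Rightarrow> label \<Rightarrow> nat set" where
  "discarded \<epsilon> k I ord (Large_Group j) =
     size_class (shift_param \<epsilon> k I (Large_Group j)) (ord (Large_Group j)) 0"
| "discarded \<epsilon> k I ord Small_Groups =
     (let Q = shift_param \<epsilon> k I Small_Groups; xs = ord Small_Groups
      in size_class Q xs 0 \<union> size_class Q xs (last_class Q xs))"

text \<open>Items outside all the shifted sets, i.e. the small items and the medium items of small groups,
  belong to the rounded instance with their original sizes.\<close>

definition rounded_items :: "real \<Rightarrow> nat \<Rightarrow> gbp \<Rightarrow> (label \<Rightarrow> nat list) \<Rightarrow> nat set" where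
  "rounded_items \<epsilon> k I ord = items I - (\<Union>a\<in>labels \<epsilon> k I. discarded \<epsilon> k I ord a)"

definition rounded_size :: "real \<Rightarrow> nat \<Rightarrow> gbp \<Rightarrow> (label \<Rightarrow> nat list) \<Rightarrow> nat \<Rightarrow> real" where
  "rounded_size \<epsilon> k I ord l =
     (let a = label_of \<epsilon> k I l
      in if l \<in> shift_set \<epsilon> k I a
         then shifted_size (isize I) (shift_param \<epsilon> k I a) (ord a) l
         else isize I l)"

text \<open>The items handled by the algorithm: the remaining large and medium items of large groups and
  the remaining large items of small groups.\<close>

definition large_group_items :: "real \<Rightarrow> nat \<Rightarrow> gbp \<Rightarrow> (label \<Rightarrow> nat list) \<Rightarrow> nat set" where
  "large_group_items \<epsilon> k I ord =
     {l \<in> rounded_items \<epsilon> k I ord. large_group \<epsilon> k I (grp I l) \<and> large_or_medium \<epsilon> k I l}"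

definition small_group_items :: "real \<Rightarrow> nat \<Rightarrow> gbp \<Rightarrow> (label \<Rightarrow> nat list) \<Rightarrow> nat set" where
  "small_group_items \<epsilon> k I ord =
     {l \<in> rounded_items \<epsilon> k I ord. small_group \<epsilon> k I (grp I l) \<and> large_item \<epsilon> k I l}"

definition slot_items :: "real \<Rightarrow> nat \<Rightarrow> gbp \<Rightarrow> (label \<Rightarrow> nat list) \<Rightarrow> nat set" where
  "slot_items \<epsilon> k I ord = large_group_items \<epsilon> k I ord \<union> small_group_items \<epsilon> k I ord"


section \<open>Slots, patterns and assignments\<close>

type_synonym slot = "real \<times> label"

definition slot_of :: "real \<Rightarrow> nat \<Rightarrow> gbp \<Rightarrow> (label \<Rightarrow> nat list) \<Rightarrow> nat \<Rightarrow> slot" where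
  "slot_of \<epsilon> k I ord l = (rounded_size \<epsilon> k I ord l, label_of \<epsilon> k I l)"

definition slots :: "real \<Rightarrow> nat \<Rightarrow> gbp \<Rightarrow> (label \<Rightarrow> nat list) \<Rightarrow> slot set" where
  "slots \<epsilon> k I ord =
     rounded_size \<epsilon> k I ord ` {l \<in> rounded_items \<epsilon> k I ord. large_or_medium \<epsilon> k I l}
       \<times> labels \<epsilon> k I"

definition pattern :: "real \<Rightarrow> nat \<Rightarrow> gbp \<Rightarrow> (label \<Rightarrow> nat list) \<Rightarrow> slot multiset \<Rightarrow> bool" where
  "pattern \<epsilon> k I ord M \<longleftrightarrow>
     set_mset M \<subseteq> slots \<epsilon> k I ord \<and> size M \<le> nat \<lfloor>1 / \<epsilon> ^ (k + 1)\<rfloor>"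

definition corresponds_to_optimal ::
    "real \<Rightarrow> nat \<Rightarrow> gbp \<Rightarrow> (label \<Rightarrow> nat list) \<Rightarrow> (nat \<Rightarrow> slot multiset) \<Rightarrow> bool" where
  "corresponds_to_optimal \<epsilon> k I ord \<zeta> \<longleftrightarrow>
     (\<forall>b\<in>{1..OPT I}. pattern \<epsilon> k I ord (\<zeta> b)) \<and>
     (\<exists>P. packs_within_capacity (rounded_items \<epsilon> k I ord) (rounded_size \<epsilon> k I ord) (OPT I) P \<and>
          (\<forall>l\<in>rounded_items \<epsilon> k I ord. \<forall>z\<in>rounded_items \<epsilon> k I ord. conflict (grp I) P l z \<longrightarrow>
             l \<in> small_group_items \<epsilon> k I ord \<or> z \<in> small_group_items \<epsilon> k I ord) \<and>
          (\<forall>b\<in>{1..OPT I}.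
             image_mset (slot_of \<epsilon> k I ord) (mset_set {l \<in> slot_items \<epsilon> k I ord. P l = b}) = \<zeta> b))"


section \<open>Swaps\<close>

text \<open>\<open>item_clashes A g P x b\<close>: item \<open>x\<close> conflicts with an item (other than itself) in bin \<open>b\<close>, where
  \<open>A\<close> is the set of all packed items; \<open>x\<close> need not be in \<open>b\<close>.\<close>

definition item_clashes ::
    "nat set \<Rightarrow> (nat \<Rightarrow> nat) \<Rightarrow> (nat \<Rightarrow> nat) \<Rightarrow> nat \<Rightarrow> nat \<Rightarrow> bool" where
  "item_clashes A g P x b \<longleftrightarrow> (\<exists>z\<in>A. z \<noteq> x \<and> P z = b \<and> g z = g x)"

definition bad_swap :: "nat set \<Rightarrow> (nat \<Rightarrow> nat) \<Rightarrow> (nat \<Rightarrow> nat) \<Rightarrow> nat \<Rightarrow> nat \<Rightarrow> bool" where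
  "bad_swap A g P l y \<longleftrightarrow>
     item_clashes A g P y (P l) \<or> item_clashes A g P l (P y) \<or> P y = P l"

definition good_swap ::
    "nat set \<Rightarrow> (nat \<Rightarrow> real) \<Rightarrow> (nat \<Rightarrow> nat) \<Rightarrow> (nat \<Rightarrow> nat) \<Rightarrow> nat \<Rightarrow> nat \<Rightarrow> bool" where
  "good_swap A s g P l y \<longleftrightarrow> s y = s l \<and> \<not> bad_swap A g P l y"

definition swap :: "(nat \<Rightarrow> nat) \<Rightarrow> nat \<Rightarrow> nat \<Rightarrow> nat \<Rightarrow> nat" where
  "swap P l y = P(l := P y, y := P l)"


section \<open>The algorithm, with its running time\<close>

text \<open>Running time is the number of elementary operations (comparing two items or slots, moving an
  item, advancing a scan).  Every procedure returns its result together with that number.  Whenever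
  the algorithm has to find something it scans a list until a test succeeds; its arbitrary choices
  are modelled by letting the order of the scanned list be arbitrary.\<close>

fun search :: "('a \<Rightarrow> bool \<times> nat) \<Rightarrow> 'a list \<Rightarrow> 'a option \<times> nat" where
  "search f [] = (None, 1)"
| "search f (x # xs) =
     (case f x of (found, t) \<Rightarrow>
        if found then (Some x, t + 1)
        else (case search f xs of (r, t') \<Rightarrow> (r, t + t' + 1)))"

definition clash_test ::
    "nat list \<Rightarrow> (nat \<Rightarrow> nat) \<Rightarrow> (nat \<Rightarrow> nat) \<Rightarrow> nat \<Rightarrow> nat \<Rightarrow> bool \<times> nat" where
  "clash_test xs g P x b =
     (case search (\<lambda>z. (z \<noteq> x \<and> P z = b \<and> g z = g x, 3)) xs of (r, t) \<Rightarrow> (r \<noteq> None, t))"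

definition conflict_test ::
    "nat list \<Rightarrow> (nat \<Rightarrow> nat) \<Rightarrow> (nat \<Rightarrow> nat) \<Rightarrow> nat \<Rightarrow> bool \<times> nat" where
  "conflict_test xs g P l = clash_test xs g P l (P l)"

definition good_swap_test ::
    "nat list \<Rightarrow> (nat \<Rightarrow> real) \<Rightarrow> (nat \<Rightarrow> nat) \<Rightarrow> (nat \<Rightarrow> nat) \<Rightarrow> nat \<Rightarrow> nat \<Rightarrow> bool \<times> nat" where
  "good_swap_test xs s g P l y =
     (case clash_test xs g P y (P l) of (c, t) \<Rightarrow>
      case clash_test xs g P l (P y) of (c', t') \<Rightarrow>
        (s y = s l \<and> \<not> c \<and> \<not> c' \<and> P y \<noteq> P l, t + t' + 2))"

text \<open>Steps 1 and 2: \<open>fill v ls os P os' P' t\<close> puts the items of \<open>ls\<close> one after the other into open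
  slots.  \<open>v l\<close> is the slot that item \<open>l\<close> needs, and \<open>(w, b)\<close> in the list \<open>os\<close> is an open slot \<open>w\<close> of
  bin \<open>b\<close>.  There is no rule for an item without matching open slot, so then no run exists.\<close>

inductive fill :: "(nat \<Rightarrow> slot) \<Rightarrow> nat list \<Rightarrow> (slot \<times> nat) list \<Rightarrow> (nat \<Rightarrow> nat)
    \<Rightarrow> (slot \<times> nat) list \<Rightarrow> (nat \<Rightarrow> nat) \<Rightarrow> nat \<Rightarrow> bool" for v where
  fill_done: "fill v [] os P os P 1"
| fill_item: "search (\<lambda>(w, b). (w = v l, 1)) os = (Some (w, b), t) \<Longrightarrow>
     fill v ls (remove1 (w, b) os) (P(l := b)) os' P' t' \<Longrightarrow>
     fill v (l # ls) os P os' P' (t + t' + 2)"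

text \<open>Step 3: in iteration \<open>i\<close> the conflicting item is searched along \<open>fst (\<sigma> i)\<close> and its partner
  along \<open>snd (\<sigma> i)\<close>.  For given \<open>\<sigma>\<close> the loop is deterministic (see below), and there is no rule for a
  conflicting item without good swap; hence a derivation of \<open>swap_loop s g \<sigma> 0 P P' t\<close> exists iff the
  loop, started in \<open>P\<close>, neither gets stuck nor runs forever.\<close>

inductive swap_loop :: "(nat \<Rightarrow> real) \<Rightarrow> (nat \<Rightarrow> nat) \<Rightarrow> (nat \<Rightarrow> nat list \<times> nat list) \<Rightarrow> nat
    \<Rightarrow> (nat \<Rightarrow> nat) \<Rightarrow> (nat \<Rightarrow> nat) \<Rightarrow> nat \<Rightarrow> bool" for s g \<sigma> where
  no_conflict: "search (conflict_test (fst (\<sigma> i)) g P) (fst (\<sigma> i)) = (None, t) \<Longrightarrow>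
     swap_loop s g \<sigma> i P P t"
| perform_swap: "search (conflict_test (fst (\<sigma> i)) g P) (fst (\<sigma> i)) = (Some l, t) \<Longrightarrow>
     search (good_swap_test (snd (\<sigma> i)) s g P l) (snd (\<sigma> i)) = (Some y, t') \<Longrightarrow>
     swap_loop s g \<sigma> (Suc i) (swap P l y) P' t'' \<Longrightarrow>
     swap_loop s g \<sigma> i P P' (t + t' + t'' + 2)"

definition enumerates :: "'a list \<Rightarrow> 'a set \<Rightarrow> bool" where
  "enumerates xs A \<longleftrightarrow> distinct xs \<and> set xs = A"

definition lists_slots :: "(slot \<times> nat) list \<Rightarrow> nat \<Rightarrow> (nat \<Rightarrow> slot multiset) \<Rightarrow> bool" where
  "lists_slots os m \<zeta> \<longleftrightarrow> mset os = (\<Sum>b\<in>{1..m}. image_mset (\<lambda>w. (w, b)) (\<zeta> b))"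

text \<open>The arbitrary choices of a run: the orders in which the slots of \<open>\<zeta>\<close> (\<open>os\<close>), the items of large
  groups (\<open>ls\<close>), the items of small groups (\<open>us\<close>) and, in each iteration of the loop, all packed items
  (\<open>\<sigma>\<close>) are processed.\<close>

definition swapping_choices :: "real \<Rightarrow> nat \<Rightarrow> gbp \<Rightarrow> (label \<Rightarrow> nat list) \<Rightarrow> (nat \<Rightarrow> slot multiset)
    \<Rightarrow> (slot \<times> nat) list \<Rightarrow> nat list \<Rightarrow> nat list \<Rightarrow> (nat \<Rightarrow> nat list \<times> nat list) \<Rightarrow> bool" where
  "swapping_choices \<epsilon> k I ord \<zeta> os ls us \<sigma> \<longleftrightarrow>
     lists_slots os (OPT I) \<zeta> \<and>
     enumerates ls (large_group_items \<epsilon> k I ord) \<and>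
     enumerates us (small_group_items \<epsilon> k I ord) \<and>
     (\<forall>i. enumerates (fst (\<sigma> i)) (slot_items \<epsilon> k I ord) \<and>
          enumerates (snd (\<sigma> i)) (slot_items \<epsilon> k I ord))"

text \<open>The run with these choices ends with the packing \<open>P\<close> after \<open>t\<close> elementary operations.
  Bin \<open>0\<close> does not exist; it marks items that are not packed yet.\<close>

definition Swapping :: "real \<Rightarrow> nat \<Rightarrow> gbp \<Rightarrow> (label \<Rightarrow> nat list)
    \<Rightarrow> (slot \<times> nat) list \<Rightarrow> nat list \<Rightarrow> nat list \<Rightarrow> (nat \<Rightarrow> nat list \<times> nat list)
    \<Rightarrow> (nat \<Rightarrow> nat) \<Rightarrow> nat \<Rightarrow> bool" where
  "Swapping \<epsilon> k I ord os ls us \<sigma> P t \<longleftrightarrow>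
     (\<exists>os1 P1 t1 os2 P2 t2 t3.
        fill (slot_of \<epsilon> k I ord) ls os (\<lambda>_. 0) os1 P1 t1 \<and>
        fill (slot_of \<epsilon> k I ord) us os1 P1 os2 P2 t2 \<and>
        swap_loop (rounded_size \<epsilon> k I ord) (grp I) \<sigma> 0 P2 P t3 \<and>
        t = t1 + t2 + t3)"

text \<open>The tests decide what they should, and the searches find every item with the desired property
  for some order of the list.\<close>

lemma search_None_iff: "fst (search f xs) = None \<longleftrightarrow> (\<forall>x\<in>set xs. \<not> fst (f x))"
  by (induction xs) (auto split: prod.splits)

lemma search_Some: "search f xs = (Some x, t) \<Longrightarrow> x \<in> set xs \<and> fst (f x)"
  by (induction xs arbitrary: t) (auto split: prod.splits if_splits)

lemma search_hd: "fst (f x) \<Longrightarrow> fst (search f (x # xs)) = Some x"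
  by (auto split: prod.splits)

lemma clash_test_iff: "fst (clash_test xs g P x b) \<longleftrightarrow> item_clashes (set xs) g P x b"
  using search_None_iff[of "\<lambda>z. (z \<noteq> x \<and> P z = b \<and> g z = g x, 3)" xs]
  by (auto simp: clash_test_def item_clashes_def split: prod.splits)

lemma conflict_test_iff: "fst (conflict_test xs g P l) \<longleftrightarrow> (\<exists>z\<in>set xs. conflict g P l z)"
  unfolding conflict_test_def clash_test_iff item_clashes_def conflict_def by metis

lemma good_swap_test_iff: "fst (good_swap_test xs s g P l y) \<longleftrightarrow> good_swap (set xs) s g P l y"
  using clash_test_iff[of xs g P y "P l"] clash_test_iff[of xs g P l "P y"]
  by (auto simp: good_swap_test_def good_swap_def bad_swap_def split: prod.splits)

lemma fill_deterministic:
  "fill v ls os P os1 P1 t1 \<Longrightarrow> fill v ls os P os2 P2 t2 \<Longrightarrow> os1 = os2 \<and> P1 = P2 \<and> t1 = t2"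
proof (induction arbitrary: os2 P2 t2 rule: fill.induct)
  case (fill_done os P)
  then show ?case by (auto elim: fill.cases)
next
  case (fill_item l os w b t ls P os' P' t')
  note IH = fill_item.IH and hyp = fill_item.hyps(1)
  from fill_item.prems show ?case
  proof (cases rule: fill.cases)
    case (fill_item w2 b2 t3 t3')
    with hyp
    have "w2 = w" "b2 = b" "t3 = t" by simp_all
    with fill_item IH show ?thesis by metis
  qed
qed

lemma swap_loop_deterministic:
  "swap_loop s g \<sigma> i P P1 t1 \<Longrightarrow> swap_loop s g \<sigma> i P P2 t2 \<Longrightarrow> P1 = P2 \<and> t1 = t2"
proof (induction arbitrary: P2 t2 rule: swap_loop.induct)
  case (no_conflict i P t)
  from no_conflict.prems show ?case
    by (cases rule: swap_loop.cases) (use no_conflict.hyps in auto)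
next
  case (perform_swap i P l t y t' P' t'')
  from perform_swap.prems show ?case
    by (cases rule: swap_loop.cases) (use perform_swap.hyps(1,2) perform_swap.IH in auto)
qed

lemma Swapping_deterministic:
  assumes "Swapping \<epsilon> k I ord os ls us \<sigma> P t" "Swapping \<epsilon> k I ord os ls us \<sigma> P' t'"
  shows "P = P' \<and> t = t'"
  using assms unfolding Swapping_def by (metis fill_deterministic swap_loop_deterministic)

end

theory Submission
  imports Defs "HOL-Combinatorics.Transposition"
begin

text \<open>Only large items of small groups can be in conflict, and this persists because a good swap
  never creates a conflict.  An item \<open>l\<close> in conflict in bin \<open>b\<close> lies in a full size class, which
  offers \<open>max {\<lfloor>2\<epsilon> OPT\<rfloor>, 1}\<close> partners of the same rounded size.  A bin holds at most \<open>\<epsilon>\<^bsup>-k\<^esup>\<close> large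
  items, each from a group with fewer than \<open>\<epsilon>\<^bsup>k+2\<^esup> OPT\<close> of them, so at most about \<open>\<epsilon>\<^sup>2 OPT\<close> partners
  conflict with bin \<open>b\<close>, and at most \<open>\<epsilon>\<^sup>2 OPT\<close> lie in a bin with an item of the group of \<open>l\<close>; some
  partner is good.  Each swap removes \<open>l\<close> from the set of conflicting items, so at most \<open>N\<close> swaps
  are performed.\<close>

section \<open>Running time of the searches\<close>

lemma search_time_le:
  assumes "\<And>x. x \<in> set xs \<Longrightarrow> snd (f x) \<le> T"
  shows "snd (search f xs) \<le> (T + 1) * length xs + 1"
  using assms
proof (induction xs)
  case (Cons x xs)
  have "snd (f x) \<le> T" "snd (search f xs) \<le> (T + 1) * length xs + 1"
    using Cons by auto
  then show ?case
    by (auto split: prod.splits)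
qed simp

lemma clash_test_time_le: "snd (clash_test xs g P x b) \<le> 4 * length xs + 1"
  using search_time_le[of xs "\<lambda>z. (z \<noteq> x \<and> P z = b \<and> g z = g x, 3)" 3]
  by (auto simp: clash_test_def split: prod.splits)

lemma conflict_search_time_le:
  "snd (search (conflict_test xs g P) xs) \<le> (4 * length xs + 2) * length xs + 1"
  using search_time_le[of xs "conflict_test xs g P" "4 * length xs + 1"]
    clash_test_time_le[of xs g P]
  by (simp add: conflict_test_def)

lemma good_swap_test_time_le: "snd (good_swap_test xs s g P l y) \<le> 8 * length xs + 4"
  using clash_test_time_le[of xs g P y "P l"] clash_test_time_le[of xs g P l "P y"]
  by (auto simp: good_swap_test_def split: prod.splits)

lemma good_swap_search_time_le:
  "snd (search (good_swap_test xs s g P l) xs) \<le> (8 * length xs + 5) * length xs + 1"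
  using search_time_le[of xs "good_swap_test xs s g P l" "8 * length xs + 4"]
    good_swap_test_time_le[of xs s g P l]
  by (simp add: add.commute)


section \<open>Filling the slots\<close>

text \<open>Whichever matching slot the scan takes, one copy of \<open>v l\<close> leaves both the
  demand and the supply, so the multiset inclusion survives and the filling never gets stuck. The
  last conclusion records which slots were consumed; capacities are later transferred through
  it.\<close>

lemma fill_succeeds:
  assumes "distinct ls" and "image_mset v (mset ls) \<subseteq># image_mset fst (mset os)"
  shows "\<exists>os' P' t. fill v ls os P os' P' t \<and> t \<le> length ls * (2 * length os + 3) + 1 \<and>
    (\<forall>l. l \<notin> set ls \<longrightarrow> P' l = P l) \<and>
    mset os = mset os' + image_mset (\<lambda>l. (v l, P' l)) (mset ls)"
  using assms
proof (induction ls arbitrary: os P)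
  case Nil
  show ?case
    by (rule exI[of _ os], rule exI[of _ P], rule exI[of _ 1]) (use fill_done in auto)
next
  case (Cons l ls)
  let ?f = "\<lambda>(w, b). (w = v l, 1)" and ?n = "length os"
  have "v l \<in># image_mset fst (mset os)"
    using Cons.prems(2) by (auto dest: mset_subset_eqD)
  then have "fst (search ?f os) \<noteq> None"
    unfolding search_None_iff by fastforce
  then obtain w b t where srch: "search ?f os = (Some (w, b), t)"
    by (cases "search ?f os") auto
  have wb: "(w, b) \<in> set os" and w: "w = v l"
    using search_Some[OF srch] by auto
  have t: "t \<le> 2 * ?n + 1"
    using search_time_le[of os ?f 1] srch by (auto split: prod.splits)
  let ?os = "remove1 (w, b) os"
  have os: "mset os = add_mset (w, b) (mset ?os)"
    using wb by simp
  have "image_mset v (mset ls) \<subseteq># image_mset fst (mset ?os)"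
    using Cons.prems(2) unfolding os w by simp
  then obtain os' P' t' where
    run: "fill v ls ?os (P(l := b)) os' P' t'" and
    t': "t' \<le> length ls * (2 * length ?os + 3) + 1" and
    outside: "\<forall>z. z \<notin> set ls \<longrightarrow> P' z = (P(l := b)) z" and
    rest: "mset ?os = mset os' + image_mset (\<lambda>l. (v l, P' l)) (mset ls)"
    using Cons.IH[of ?os "P(l := b)"] Cons.prems(1) by fastforce
  have "P' l = b"
    using outside Cons.prems(1) by auto
  then have "mset os = mset os' + image_mset (\<lambda>l. (v l, P' l)) (mset (l # ls))"
    using rest w unfolding os by simp
  moreover have "fill v (l # ls) os P os' P' (t + t' + 2)"
    by (rule fill_item[OF srch run])
  \<comment> \<open>The factor \<open>2 * ?n + 3\<close> is one scan, at most
    \<open>2 * ?n + 1\<close>, plus the 2 operations charged by \<open>fill_item\<close>; later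
    scans run over a shorter list.\<close>
  moreover have "t + t' + 2 \<le> length (l # ls) * (2 * ?n + 3) + 1"
  proof -
    have "length ls * (2 * length ?os + 3) \<le> length ls * (2 * ?n + 3)"
      by (intro mult_le_mono2) (simp add: length_remove1)
    then have "t' \<le> length ls * (2 * ?n + 3) + 1"
      using t' by linarith
    then show ?thesis using t by simp
  qed
  moreover have "\<forall>z. z \<notin> set (l # ls) \<longrightarrow> P' z = P z"
    using outside by auto
  ultimately show ?case by blast
qed

text \<open>Demand equals supply, so the first phase leaves exactly the slots that \<open>us\<close>
  asks for and the second leaves none.\<close>

lemma fill_both_succeeds:
  assumes "distinct (ls @ us)" and "image_mset v (mset (ls @ us)) = image_mset fst (mset os)"
  shows "\<exists>os1 P1 t1 os2 P2 t2. fill v ls os P os1 P1 t1 \<and> fill v us os1 P1 os2 P2 t2 \<and>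
    t1 + t2 \<le> length (ls @ us) * (2 * length (ls @ us) + 3) + 2 \<and>
    mset os = image_mset (\<lambda>l. (v l, P2 l)) (mset (ls @ us))"
proof -
  have len: "length os = length (ls @ us)"
    using arg_cong[OF assms(2), of size] by simp
  have "image_mset v (mset ls) \<subseteq># image_mset fst (mset os)"
    unfolding assms(2)[symmetric] by simp
  then obtain os1 P1 t1 where
    1: "fill v ls os P os1 P1 t1" "t1 \<le> length ls * (2 * length os + 3) + 1"
      "mset os = mset os1 + image_mset (\<lambda>l. (v l, P1 l)) (mset ls)"
    using fill_succeeds[of ls v os P] assms(1) by auto
  have us: "image_mset v (mset us) = image_mset fst (mset os1)"
    using assms(2) unfolding 1(3) by (simp add: multiset.map_comp comp_def)
  then obtain os2 P2 t2 where
    2: "fill v us os1 P1 os2 P2 t2" "t2 \<le> length us * (2 * length os1 + 3) + 1"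
      "\<forall>l. l \<notin> set us \<longrightarrow> P2 l = P1 l"
      "mset os1 = mset os2 + image_mset (\<lambda>l. (v l, P2 l)) (mset us)"
    using fill_succeeds[of us v os1 P1] assms(1) by auto
  have len1: "length os1 = length us"
    using arg_cong[OF us, of size] by simp
  have "size (mset os2) = 0"
    using arg_cong[OF 2(4), of size] len1 by simp
  moreover have "image_mset (\<lambda>l. (v l, P1 l)) (mset ls) = image_mset (\<lambda>l. (v l, P2 l)) (mset ls)"
    using 2(3) assms(1) by (intro image_mset_cong) auto
  ultimately have "mset os = image_mset (\<lambda>l. (v l, P2 l)) (mset (ls @ us))"
    using 1(3) 2(4) by simp
  moreover have "t1 + t2 \<le> length (ls @ us) * (2 * length (ls @ us) + 3) + 2"
  proof -
    have "length us * (2 * length os1 + 3) \<le> length us * (2 * length (ls @ us) + 3)"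
      unfolding len1 by simp
    then show ?thesis
      using 1(2) 2(2) unfolding len by (simp add: algebra_simps)
  qed
  ultimately show ?thesis
    using 1(1) 2(1) by blast
qed

text \<open>Each item contributes only to the summand of its own bin. This turns the patterns of an
  optimal packing into one multiset of slot-bin pairs, the form in which \<open>lists_slots\<close>
  gives the open slots.\<close>

lemma sum_image_mset_fibres:
  assumes "finite A" and "finite B" and "P ` A \<subseteq> B"
  shows "(\<Sum>b\<in>B. image_mset (\<lambda>w. (w, b)) (image_mset v (mset_set {l \<in> A. P l = b}))) =
    image_mset (\<lambda>l. (v l, P l)) (mset_set A)"
  using assms(1,3)
proof (induction A rule: finite_induct)
  case empty
  then show ?case by simp
next
  case (insert a A)
  let ?F = "\<lambda>A b. image_mset (\<lambda>w. (w, b)) (image_mset v (mset_set {l \<in> A. P l = b}))"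
  have "?F (insert a A) b = ?F A b + (if P a = b then {#(v a, b)#} else {#})" for b
  proof -
    have "{l \<in> insert a A. P l = b} =
        (if P a = b then insert a {l \<in> A. P l = b} else {l \<in> A. P l = b})"
      by auto
    then show ?thesis
      using insert.hyps by simp
  qed
  then have "(\<Sum>b\<in>B. ?F (insert a A) b) =
      (\<Sum>b\<in>B. ?F A b) + (\<Sum>b\<in>B. if P a = b then {#(v a, b)#} else {#})"
    by (simp add: sum.distrib)
  also have "(\<Sum>b\<in>B. if P a = b then {#(v a, b)#} else {#}) = {#(v a, P a)#}"
    using insert.prems assms(2) by (subst sum.delta') auto
  finally show ?case
    using insert by simp
qed


section \<open>Swaps and the loop\<close>

lemma sum_fibre_eq: "finite A \<Longrightarrow> (\<Sum>l | l \<in> A \<and> P l = b. s l) = (\<Sum>l\<in>A. if P l = b then s l else 0)"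
  by (simp add: sum.If_cases Int_def)

text \<open>The new packing is \<open>P\<close> composed with the transposition of \<open>l\<close>
  and \<open>y\<close>, which permutes \<open>A\<close> and preserves sizes, so every load is merely
  reindexed.\<close>

lemma packs_within_capacity_swap:
  assumes "finite A" and "packs_within_capacity A s m P" and "l \<in> A" "y \<in> A" "s y = s l"
  shows "packs_within_capacity A s m (swap P l y)"
proof -
  let ?\<tau> = "transpose l y"
  have P: "swap P l y z = P (?\<tau> z)" and s: "s (?\<tau> z) = s z" for z
    using assms(5) by (auto simp: swap_def transpose_def)
  have bij: "bij_betw ?\<tau> A A"
    by (rule bij_betw_byWitness[of _ ?\<tau>]) (use assms(3,4) in \<open>auto simp: transpose_def\<close>)
  have "(\<Sum>z | z \<in> A \<and> swap P l y z = b. s z) = (\<Sum>z | z \<in> A \<and> P z = b. s z)" for b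
    using sum.reindex_bij_betw[OF bij, of "\<lambda>z. if P z = b then s z else 0"]
    unfolding sum_fibre_eq[OF assms(1)] P s .
  moreover have "\<forall>z\<in>A. swap P l y z \<in> P ` A"
    using assms(3,4) by (auto simp: swap_def)
  ultimately show ?thesis
    using assms(2) unfolding packs_within_capacity_def by fastforce
qed

text \<open>A good swap moves \<open>l\<close> and \<open>y\<close> into bins free of other items of
  their groups, so any conflict afterwards joins two unmoved items and existed before.\<close>

lemma conflict_swapD:
  assumes "good_swap A s g P l y" and "l \<in> A" "y \<in> A" "u \<in> A" "z \<in> A"
    and "conflict g (swap P l y) u z"
  shows "conflict g P u z \<and> u \<noteq> l"
  using assms unfolding good_swap_def bad_swap_def item_clashes_def conflict_def swap_def
  by (auto split: if_splits)

definition conflicting :: "nat set \<Rightarrow> (nat \<Rightarrow> nat) \<Rightarrow> (nat \<Rightarrow> nat) \<Rightarrow> nat set" where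
  "conflicting A g P = {l \<in> A. \<exists>z\<in>A. conflict g P l z}"

text \<open>Induction on the number of conflicting items: a good swap removes \<open>l\<close> from
  them and adds none, so the confinement to \<open>S\<close> persists and \<open>good\<close>
  applies again. With \<open>n = card A\<close>, a round costs at most \<open>(4n+2)n+1\<close> and
  \<open>(8n+5)n+1\<close> for its two searches, plus 2; the extra round pays for the final
  unsuccessful search.\<close>

lemma swap_loop_terminates:
  assumes "finite A"
    and enum: "\<And>i. enumerates (fst (\<sigma> i)) A" "\<And>i. enumerates (snd (\<sigma> i)) A"
    and good: "\<And>P l. \<lbrakk>packs_within_capacity A s m P; conflicting A g P \<subseteq> S; l \<in> conflicting A g P\<rbrakk>
      \<Longrightarrow> \<exists>y\<in>A. good_swap A s g P l y"
    and "packs_within_capacity A s m P" and "conflicting A g P \<subseteq> S"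
  shows "\<exists>P' t. swap_loop s g \<sigma> i P P' t \<and> feasible_packing A s g m P' \<and>
    t \<le> (card (conflicting A g P) + 1) * ((12 * card A + 7) * card A + 4)"
  using assms(5,6)
proof (induction "card (conflicting A g P)" arbitrary: P i rule: less_induct)
  case less
  let ?n = "card A" and ?D = "conflicting A g"
  let ?xs = "fst (\<sigma> i)" and ?ys = "snd (\<sigma> i)"
  have set: "set ?xs = A" "set ?ys = A" and len: "length ?xs = ?n" "length ?ys = ?n"
    using enum[of i] by (auto simp: enumerates_def dest: distinct_card)
  let ?search = "search (conflict_test ?xs g P) ?xs"
  have time: "snd ?search \<le> (4 * ?n + 2) * ?n + 1"
    using conflict_search_time_le[of ?xs g P] len by simp
  show ?case
  proof (cases "fst ?search")
    case None
    then have "swap_loop s g \<sigma> i P P (snd ?search)"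
      by (intro no_conflict) (metis prod.collapse)
    moreover have "feasible_packing A s g m P"
      using None less.prems(1)
      unfolding search_None_iff conflict_test_iff set feasible_packing_def by blast
    moreover have "snd ?search \<le> (card (?D P) + 1) * ((12 * ?n + 7) * ?n + 4)"
      using time by (simp add: algebra_simps)
    ultimately show ?thesis by blast
  next
    case (Some l)
    then have s1: "?search = (Some l, snd ?search)"
      by (metis prod.collapse)
    then have l: "l \<in> ?D P"
      using search_Some[OF s1] unfolding conflict_test_iff set conflicting_def by auto
    let ?search' = "search (good_swap_test ?ys s g P l) ?ys"
    have "fst ?search' \<noteq> None"
      using good[OF less.prems l] unfolding search_None_iff good_swap_test_iff set by blast
    then obtain y where s2: "?search' = (Some y, snd ?search')"
      by (cases ?search') auto
    have y: "y \<in> A" "good_swap A s g P l y"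
      using search_Some[OF s2] unfolding good_swap_test_iff set by auto
    have time': "snd ?search' \<le> (8 * ?n + 5) * ?n + 1"
      using good_swap_search_time_le[of ?ys s g P l] len by simp
    let ?P = "swap P l y"
    have lA: "l \<in> A" using l by (simp add: conflicting_def)
    have cap: "packs_within_capacity A s m ?P"
      using packs_within_capacity_swap[OF assms(1) less.prems(1) lA y(1)] y(2)
      by (simp add: good_swap_def)
    have sub: "?D ?P \<subseteq> ?D P - {l}"
      using conflict_swapD[OF y(2) lA y(1)] unfolding conflicting_def by blast
    have fin: "finite (?D P)"
      using assms(1) by (simp add: conflicting_def)
    have cd: "card (?D ?P) + 1 \<le> card (?D P)"
      using card_mono[OF _ sub] fin l by (simp add: card_Diff_singleton)
        (metis One_nat_def Suc_le_eq Suc_pred card_gt_0_iff empty_iff le_trans not_less_eq_eq)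
    obtain P' t where run: "swap_loop s g \<sigma> (Suc i) ?P P' t" "feasible_packing A s g m P'"
      and t: "t \<le> (card (?D ?P) + 1) * ((12 * ?n + 7) * ?n + 4)"
      using less.hyps[of ?P "Suc i"] cd cap sub less.prems(2) by auto
    have "t \<le> card (?D P) * ((12 * ?n + 7) * ?n + 4)"
      using t mult_le_mono1[OF cd] by (rule le_trans)
    then have "snd ?search + snd ?search' + t + 2 \<le>
        (card (?D P) + 1) * ((12 * ?n + 7) * ?n + 4)"
      using time time' by (simp add: algebra_simps)
    with perform_swap[OF s1 s2 run(1)] run(2) show ?thesis by blast
  qed
qed


section \<open>Existence of good swaps\<close>

text \<open>Volume argument: these items alone must fit into capacity 1. The item \<open>l\<close>
  ensures that \<open>P l\<close> is a bin whose load is bounded.\<close>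

lemma card_in_bin_le:
  assumes "finite A" "packs_within_capacity A s m P" "S \<subseteq> A"
    and "\<And>z. z \<in> A \<Longrightarrow> 0 \<le> s z" "\<And>z. z \<in> S \<Longrightarrow> \<delta> \<le> s z" "0 < \<delta>" "l \<in> A"
  shows "real (card {z \<in> S. P z = P l}) \<le> 1 / \<delta>"
proof -
  have "real (card {z \<in> S. P z = P l}) * \<delta> = (\<Sum>z | z \<in> S \<and> P z = P l. \<delta>)"
    by simp
  also have "\<dots> \<le> (\<Sum>z | z \<in> S \<and> P z = P l. s z)"
    by (intro sum_mono) (use assms in auto)
  also have "\<dots> \<le> (\<Sum>z | z \<in> A \<and> P z = P l. s z)"
    by (intro sum_mono2) (use assms in auto)
  also have "\<dots> \<le> 1"
    using assms(2,7) by (auto simp: packs_within_capacity_def)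
  finally show ?thesis
    using assms(6) by (simp add: field_simps)
qed

text \<open>The two items in conflict share a group, so a bin of at most \<open>1/\<delta>\<close> items of \<open>S\<close> meets at most
  \<open>1/\<delta> - 1\<close> groups; the gain \<open>X\<close> pays for the floor in the class size \<open>\<lfloor>2\<epsilon> OPT\<rfloor>\<close>.\<close>

lemma ex_good_swap:
  fixes X \<delta> :: real
  assumes "finite A" "packs_within_capacity A s m P" "S \<subseteq> A"
    and sizes: "\<And>z. z \<in> A \<Longrightarrow> 0 \<le> s z" "\<And>z. z \<in> S \<Longrightarrow> \<delta> \<le> s z" "0 < \<delta>"
    and closed: "\<And>y z. y \<in> S \<Longrightarrow> z \<in> A \<Longrightarrow> g z = g y \<Longrightarrow> z \<in> S"
    and groups: "\<And>y. y \<in> S \<Longrightarrow> real (card {z \<in> S. g z = g y}) \<le> X"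
    and l: "l \<in> S" "z \<in> A" "conflict g P l z"
    and C: "C \<subseteq> S" "\<And>y. y \<in> C \<Longrightarrow> s y = s l" "real (card C) > (2 / \<delta> - 1) * X"
  shows "\<exists>y\<in>C. good_swap A s g P l y"
proof (rule ccontr)
  assume none: "\<not> ?thesis"
  define B where "B = {x \<in> S. P x = P l}"
  define G where "G = {x \<in> S. g x = g l}"
  have fin: "finite S" "finite B" "finite G"
    using finite_subset[OF assms(3,1)] by (simp_all add: B_def G_def)
  have z: "z \<in> B" "l \<in> B" "g z = g l" "z \<noteq> l"
    using closed l by (auto simp: B_def conflict_def)
  have cardB: "real (card B) \<le> 1 / \<delta>"
    unfolding B_def by (rule card_in_bin_le[OF assms(1-6)]) (use l assms(3) in auto)
  \<comment> \<open>\<open>z\<close> repeats the group of \<open>l\<close>, so dropping it loses no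
    group; this yields the \<open>- 1\<close> in \<open>1 / \<delta> - 1\<close>.\<close>
  have "g ` B = g ` (B - {z})"
    using z by (intro equalityI image_mono subsetI) (auto simp: image_iff)
  then have "card (g ` B) \<le> card (B - {z})"
    using card_image_le fin by (metis finite_Diff)
  moreover have "card B > 0"
    using z fin by (auto simp: card_gt_0_iff)
  ultimately have cardgB: "real (card (g ` B)) \<le> 1 / \<delta> - 1"
    using cardB z by (simp add: card_Diff_singleton)
  have X: "0 \<le> X"
    using groups[OF l(1)] by linarith
  \<comment> \<open>\<open>?B1\<close> holds the candidates whose group occurs in the bin of
    \<open>l\<close>, \<open>?B2\<close> those sharing a bin with an item of the group of
    \<open>l\<close>. A candidate in the bin of \<open>l\<close> itself is covered as well, because
    \<open>l\<close> is in \<open>G\<close>. The bounds \<open>(1 / \<delta> - 1) * X\<close> and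
    \<open>X / \<delta>\<close> add up to the threshold for \<open>C\<close>.\<close>
  let ?B1 = "\<Union>j\<in>g ` B. {y \<in> S. g y = j}" and ?B2 = "\<Union>x\<in>G. {y \<in> S. P y = P x}"
  have "C \<subseteq> ?B1 \<union> ?B2"
  proof
    fix y assume y: "y \<in> C"
    then have yS: "y \<in> S" using C(1) by auto
    have "bad_swap A g P l y"
      using none y C(2) unfolding good_swap_def by blast
    then consider x where "x \<in> A" "P x = P l" "g x = g y"
      | x where "x \<in> A" "P x = P y" "g x = g l"
      unfolding bad_swap_def item_clashes_def using yS assms(3) by blast
    then show "y \<in> ?B1 \<union> ?B2"
    proof cases
      case 1
      then have "x \<in> B" using closed[OF yS] by (simp add: B_def)
      then show ?thesis using 1(3) yS by (metis (mono_tags, lifting) UN_I UnI1 image_eqI mem_Collect_eq)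
    next
      case 2
      then have "x \<in> G" using closed[OF l(1)] by (simp add: G_def)
      then show ?thesis using 2(2) yS by fastforce
    qed
  qed
  then have "card C \<le> card (?B1 \<union> ?B2)"
    using fin by (intro card_mono) auto
  also have "\<dots> \<le> card ?B1 + card ?B2"
    by (rule card_Un_le)
  finally have "real (card C) \<le> real (card ?B1) + real (card ?B2)"
    by linarith
  also have "real (card ?B1) \<le> (1 / \<delta> - 1) * X"
  proof -
    have "real (card ?B1) \<le> (\<Sum>j\<in>g ` B. real (card {y \<in> S. g y = j}))"
      using card_UN_le[of "g ` B"] fin(2) by (simp flip: of_nat_sum)
    also have "\<dots> \<le> real (card (g ` B)) * X"
      by (rule sum_bounded_above) (use groups in \<open>auto simp: B_def\<close>)
    finally show ?thesis
      using mult_right_mono[OF cardgB X] by linarith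
  qed
  also have "real (card ?B2) \<le> X * (1 / \<delta>)"
  proof -
    have "real (card ?B2) \<le> (\<Sum>x\<in>G. real (card {y \<in> S. P y = P x}))"
      using card_UN_le[of G] fin(3) by (simp flip: of_nat_sum)
    also have "\<dots> \<le> real (card G) * (1 / \<delta>)"
      by (rule sum_bounded_above, rule card_in_bin_le[OF assms(1-6)])
        (use assms(3) in \<open>auto simp: G_def\<close>)
    also have "\<dots> \<le> X * (1 / \<delta>)"
      using groups[OF l(1)] sizes(3) by (intro mult_right_mono) (auto simp: G_def)
    finally show ?thesis .
  qed
  finally show False
    using C(3) by (simp add: algebra_simps)
qed


section \<open>Size classes\<close>

text \<open>Positions and quotients replace \<open>take\<close> and \<open>drop\<close>, so
  disjointness of classes becomes uniqueness of the quotient.\<close>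

lemma size_class_eq:
  "size_class Q xs c = {xs ! i | i. i < length xs \<and> i div max Q 1 = c}"
proof -
  let ?q = "max Q 1"
  have div: "i div ?q = c \<longleftrightarrow> c * ?q \<le> i \<and> i < c * ?q + ?q" for i
    using div_nat_eqI[of ?q c i] div_times_less_eq_dividend[of i ?q] dividend_less_div_times[of ?q i]
    by (auto simp: algebra_simps)
  show ?thesis (is "_ = ?R")
  proof (intro set_eqI iffI)
    fix x assume "x \<in> size_class Q xs c"
    then obtain i where "i < ?q" "c * ?q + i < length xs" "x = xs ! (c * ?q + i)"
      unfolding size_class_def by (auto simp: in_set_conv_nth)
    then show "x \<in> ?R"
      by (intro CollectI exI[of _ "c * ?q + i"]) (simp add: div)
  next
    fix x assume "x \<in> ?R"
    then obtain i where i: "i < length xs" "c * ?q \<le> i" "i < c * ?q + ?q" "x = xs ! i"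
      unfolding div by blast
    then show "x \<in> size_class Q xs c"
      unfolding size_class_def in_set_conv_nth
      by (intro exI[of _ "i - c * ?q"]) auto
  qed
qed

lemma size_class_subset: "size_class Q xs c \<subseteq> set xs"
  by (auto simp: size_class_eq)

text \<open>In a distinct list an entry has a single position, hence a single class, so the
  quantified \<open>c\<close> in \<open>shifted_size\<close> is determined.\<close>

lemma shifted_size_nth:
  assumes "distinct xs" and "i < length xs"
  shows "shifted_size s Q xs (xs ! i) = Max (s ` size_class Q xs (i div max Q 1))"
proof -
  have "xs ! i \<in> size_class Q xs c \<longleftrightarrow> c = i div max Q 1" for c
    using assms by (auto simp: size_class_eq nth_eq_iff_index_eq)
  then have "{s y | y c. xs ! i \<in> size_class Q xs c \<and> y \<in> size_class Q xs c} =
      s ` size_class Q xs (i div max Q 1)"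
    by auto
  then show ?thesis
    by (simp add: shifted_size_def)
qed

lemma shifted_size_ge:
  assumes "distinct xs" and "l \<in> set xs"
  shows "s l \<le> shifted_size s Q xs l"
proof -
  obtain i where i: "i < length xs" "l = xs ! i"
    using assms(2) by (auto simp: in_set_conv_nth)
  have "s l \<in> s ` size_class Q xs (i div max Q 1)"
    using i by (auto simp: size_class_eq)
  then show ?thesis
    unfolding i(2) shifted_size_nth[OF assms(1) i(1)] by (intro Max_ge) (auto simp: size_class_def)
qed

text \<open>\<open>last_class\<close> is the class of position \<open>length xs - 1\<close>, so an
  earlier class ends before that position and is not cut off by the end of the list.\<close>

lemma card_size_class:
  assumes "distinct xs" and "c < last_class Q xs"
  shows "card (size_class Q xs c) = max Q 1"
proof -
  let ?q = "max Q 1"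
  have "(c + 1) * ?q \<le> last_class Q xs * ?q"
    using assms(2) by (intro mult_le_mono1) simp
  also have "\<dots> \<le> length xs - 1"
    by (simp add: last_class_def)
  finally have "c * ?q + ?q \<le> length xs - 1"
    by simp
  then have "?q \<le> length xs - c * ?q"
    by linarith
  moreover have "card (size_class Q xs c) = length (take ?q (drop (c * ?q) xs))"
    unfolding size_class_def by (rule distinct_card) (simp add: assms(1))
  ultimately show ?thesis
    by simp
qed

text \<open>The class of \<open>l\<close> serves as \<open>C\<close>: it is neither first nor last,
  hence full and disjoint from both, and its members are rounded to the same maximum. Only the last
  class could be short, which is why discarding it matters.\<close>

lemma ex_full_class:
  assumes "distinct xs" "l \<in> set xs" "l \<notin> size_class Q xs 0" "l \<notin> size_class Q xs (last_class Q xs)"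
  shows "\<exists>C \<subseteq> set xs - (size_class Q xs 0 \<union> size_class Q xs (last_class Q xs)).
    card C = max Q 1 \<and> (\<forall>y\<in>C. shifted_size s Q xs y = shifted_size s Q xs l)"
proof -
  let ?q = "max Q 1"
  obtain i where i: "i < length xs" "l = xs ! i"
    using assms(2) by (auto simp: in_set_conv_nth)
  let ?c = "i div ?q"
  have "l \<in> size_class Q xs ?c"
    using i by (auto simp: size_class_eq)
  then have c: "?c \<noteq> 0" "?c \<noteq> last_class Q xs"
    using assms(3,4) by metis+
  have "?c \<le> last_class Q xs"
    unfolding last_class_def by (rule div_le_mono) (use i in simp)
  then have "card (size_class Q xs ?c) = ?q"
    using c by (intro card_size_class[OF assms(1)]) simp
  moreover have "size_class Q xs ?c \<subseteq> set xs - (size_class Q xs 0 \<union> size_class Q xs (last_class Q xs))"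
    using c assms(1) by (auto simp: size_class_eq nth_eq_iff_index_eq)
  moreover have "\<forall>y\<in>size_class Q xs ?c. shifted_size s Q xs y = shifted_size s Q xs l"
  proof
    fix y assume "y \<in> size_class Q xs ?c"
    then obtain j where j: "j < length xs" "j div ?q = ?c" "y = xs ! j"
      by (auto simp: size_class_eq)
    show "shifted_size s Q xs y = shifted_size s Q xs l"
      unfolding j(3) i(2) shifted_size_nth[OF assms(1) j(1)] shifted_size_nth[OF assms(1) i(1)] j(2) ..
  qed
  ultimately show ?thesis by blast
qed


section \<open>The rounded instance\<close>

lemma shift_ordersD:
  assumes "shift_orders \<epsilon> k I ord" and "a \<in> labels \<epsilon> k I"
  shows "distinct (ord a)" "set (ord a) = shift_set \<epsilon> k I a"
  using assms by (auto simp: shift_orders_def sorted_enum_def)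

text \<open>Lets rounded sizes inherit positivity and the lower bound \<open>\<epsilon> ^ k\<close>,
  on which counting the items of a bin relies.\<close>

lemma rounded_size_ge:
  assumes "shift_orders \<epsilon> k I ord"
  shows "isize I l \<le> rounded_size \<epsilon> k I ord l"
proof -
  have "label_of \<epsilon> k I l \<in> labels \<epsilon> k I"
    by (simp add: label_of_def labels_def)
  then show ?thesis
    using shift_ordersD[OF assms] by (simp add: rounded_size_def Let_def shifted_size_ge)
qed

lemma slot_items_subset: "slot_items \<epsilon> k I ord \<subseteq> rounded_items \<epsilon> k I ord"
  "rounded_items \<epsilon> k I ord \<subseteq> items I"
  by (auto simp: slot_items_def large_group_items_def small_group_items_def rounded_items_def)

lemma finite_items: "finite (items I)"
  by (simp add: items_def)

lemma finite_slot_items: "finite (slot_items \<epsilon> k I ord)"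
  using finite_items slot_items_subset finite_subset by metis

lemma large_item_ge: "large_item \<epsilon> k I l \<Longrightarrow> \<epsilon> ^ k \<le> isize I l"
  by (auto simp: large_item_def small_item_def medium_item_def)

text \<open>The surviving small-group items are the shifted list without its first and last class,
  so the full class of \<open>l\<close> survives as a whole.\<close>

lemma ex_small_group_class:
  assumes "shift_orders \<epsilon> k I ord" and "l \<in> small_group_items \<epsilon> k I ord"
  shows "\<exists>C \<subseteq> small_group_items \<epsilon> k I ord. card C = max (nat \<lfloor>2 * \<epsilon> * real (OPT I)\<rfloor>) 1 \<and>
    (\<forall>y\<in>C. rounded_size \<epsilon> k I ord y = rounded_size \<epsilon> k I ord l)"
proof -
  let ?Q = "shift_param \<epsilon> k I Small_Groups" and ?xs = "ord Small_Groups"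
  have u: "Small_Groups \<in> labels \<epsilon> k I"
    by (simp add: labels_def)
  note ord = shift_ordersD[OF assms(1) u]
  have size: "rounded_size \<epsilon> k I ord y = shifted_size (isize I) ?Q ?xs y" if "y \<in> set ?xs" for y
    using that ord(2) by (auto simp: rounded_size_def label_of_def small_group_def)
  have items: "y \<in> small_group_items \<epsilon> k I ord \<longleftrightarrow>
      y \<in> set ?xs - (size_class ?Q ?xs 0 \<union> size_class ?Q ?xs (last_class ?Q ?xs))" for y
  proof -
    \<comment> \<open>The items discarded for a large group belong to that group, so this never
      affects an item of a small group.\<close>
    have "y \<notin> discarded \<epsilon> k I ord (Large_Group j)"
      if "large_group \<epsilon> k I j" "small_group \<epsilon> k I (grp I y)" for j
    proof -
      have "set (ord (Large_Group j)) = shift_set \<epsilon> k I (Large_Group j)"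
        using that(1) by (intro shift_ordersD[OF assms(1)]) (simp add: labels_def)
      then show ?thesis
        using that size_class_subset[of _ "ord (Large_Group j)"] by (auto simp: small_group_def)
    qed
    then show ?thesis
      unfolding small_group_items_def rounded_items_def labels_def ord(2)
      by (auto simp: Let_def)
  qed
  obtain C where "C \<subseteq> set ?xs - (size_class ?Q ?xs 0 \<union> size_class ?Q ?xs (last_class ?Q ?xs))"
    "card C = max ?Q 1"
    "\<forall>y\<in>C. shifted_size (isize I) ?Q ?xs y = shifted_size (isize I) ?Q ?xs l"
    using ex_full_class[OF ord(1), of l ?Q "isize I"] assms(2) unfolding items by auto
  moreover from this have "C \<subseteq> small_group_items \<epsilon> k I ord"
    using items by blast
  ultimately show ?thesis
    using size assms(2) unfolding items by (intro exI[of _ C]) auto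
qed

text \<open>Here \<open>\<delta> = \<epsilon>\<^sup>k\<close> and \<open>X = \<epsilon>\<^bsup>k+2\<^esup> OPT > 3\<close>, so fewer than \<open>2\<epsilon>\<^sup>2 OPT - 3\<close> candidates are bad, while
  the size class offers more than \<open>2\<epsilon> OPT - 1\<close> of them.\<close>

lemma ex_good_swap_rounded:
  assumes "0 < \<epsilon>" "\<epsilon> < 1" "gbp_instance I" "real (OPT I) > 3 / \<epsilon> ^ (k + 2)"
    and ord: "shift_orders \<epsilon> k I ord"
    and P: "packs_within_capacity (slot_items \<epsilon> k I ord) (rounded_size \<epsilon> k I ord) m P"
    and confl: "conflicting (slot_items \<epsilon> k I ord) (grp I) P \<subseteq> small_group_items \<epsilon> k I ord"
    and l: "l \<in> conflicting (slot_items \<epsilon> k I ord) (grp I) P"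
  shows "\<exists>y\<in>slot_items \<epsilon> k I ord.
    good_swap (slot_items \<epsilon> k I ord) (rounded_size \<epsilon> k I ord) (grp I) P l y"
proof -
  let ?A = "slot_items \<epsilon> k I ord" and ?S = "small_group_items \<epsilon> k I ord"
  let ?s = "rounded_size \<epsilon> k I ord"
  define X where "X = \<epsilon> ^ (k + 2) * real (OPT I)"
  obtain z where z: "z \<in> ?A" "conflict (grp I) P l z"
    using l by (auto simp: conflicting_def)
  have lS: "l \<in> ?S" using l confl by auto
  obtain C where C: "C \<subseteq> ?S" "card C = max (nat \<lfloor>2 * \<epsilon> * real (OPT I)\<rfloor>) 1"
    "\<forall>y\<in>C. ?s y = ?s l"
    using ex_small_group_class[OF ord lS] by blast
  have "\<exists>y\<in>C. good_swap ?A ?s (grp I) P l y"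
  proof (rule ex_good_swap[where \<delta> = "\<epsilon> ^ k" and X = X and S = ?S and z = z])
    show "finite ?A" by (rule finite_slot_items)
    show "?S \<subseteq> ?A" by (simp add: slot_items_def)
    show "0 < \<epsilon> ^ k" using assms(1) by simp
    show "0 \<le> ?s y" if "y \<in> ?A" for y
    proof -
      have "0 < isize I y"
        using that assms(3) slot_items_subset by (fastforce simp: gbp_instance_def)
      then show ?thesis using rounded_size_ge[OF ord, of y] by linarith
    qed
    show "\<epsilon> ^ k \<le> ?s y" if "y \<in> ?S" for y
    proof -
      have "\<epsilon> ^ k \<le> isize I y"
        using that large_item_ge by (simp add: small_group_items_def)
      then show ?thesis using rounded_size_ge[OF ord, of y] by linarith
    qed
    \<comment> \<open>Medium items of small groups are not in \<open>slot_items\<close>, so a packed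
      item of a small group is a large item.\<close>
    show "x \<in> ?S" if "y \<in> ?S" "x \<in> ?A" "grp I x = grp I y" for x y
      using that by (auto simp: slot_items_def large_group_items_def small_group_items_def
          small_group_def)
    show "real (card {x \<in> ?S. grp I x = grp I y}) \<le> X" if "y \<in> ?S" for y
    proof -
      have "card {x \<in> ?S. grp I x = grp I y} \<le>
          card {x \<in> items I. grp I x = grp I y \<and> large_or_medium \<epsilon> k I x}"
        by (intro card_mono)
          (auto simp: finite_items small_group_items_def rounded_items_def large_or_medium_def)
      moreover have "real (card {x \<in> items I. grp I x = grp I y \<and> large_or_medium \<epsilon> k I x}) < X"
        using that unfolding small_group_items_def small_group_def large_group_def X_def by auto
      ultimately show ?thesis by linarith
    qed
    show "real (card C) > (2 / \<epsilon> ^ k - 1) * X"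
    proof -
      have "X > 3"
        using assms(1,4) by (simp add: X_def field_simps)
      \<comment> \<open>The factor \<open>\<epsilon> ^ k\<close> in the threshold for large groups
        cancels the number of large items per bin.\<close>
      moreover have "(2 / \<epsilon> ^ k - 1) * X = 2 * \<epsilon>\<^sup>2 * real (OPT I) - X"
        using assms(1) by (simp add: X_def field_simps power_add power2_eq_square)
      moreover have "2 * \<epsilon>\<^sup>2 * real (OPT I) \<le> 2 * \<epsilon> * real (OPT I)"
        using assms(1,2) by (intro mult_right_mono) (auto simp: power2_eq_square)
      moreover have "2 * \<epsilon> * real (OPT I) - 1 < real (card C)"
        unfolding C(2) by linarith
      ultimately show ?thesis by linarith
    qed
  qed (use P lS z C in auto)
  then show ?thesis
    using C(1) by (auto simp: slot_items_def)
qed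


section \<open>Packing according to \<open>\<zeta>\<close>\<close>

text \<open>No group is both large and small, so the two lists are disjoint.\<close>

lemma enumerates_append:
  assumes "enumerates ls (large_group_items \<epsilon> k I ord)" "enumerates us (small_group_items \<epsilon> k I ord)"
  shows "enumerates (ls @ us) (slot_items \<epsilon> k I ord)"
  using assms unfolding enumerates_def
  by (auto simp: slot_items_def large_group_items_def small_group_items_def small_group_def)

text \<open>Capacity and the number of slots labelled by a large group depend only on the multiset of
  pairs of slot and bin, so they carry over from the optimal packing \<open>P\<close> to \<open>P'\<close>.\<close>

lemma same_slots_transfer:
  fixes \<epsilon> k I ord
  defines "A \<equiv> slot_items \<epsilon> k I ord" and "v \<equiv> slot_of \<epsilon> k I ord"
  assumes eq: "image_mset (\<lambda>l. (v l, P' l)) (mset_set A) = image_mset (\<lambda>l. (v l, P l)) (mset_set A)"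
    and P: "packs_within_capacity A (rounded_size \<epsilon> k I ord) m P"
    and confl: "\<forall>l\<in>A. \<forall>z\<in>A. conflict (grp I) P l z \<longrightarrow>
      l \<in> small_group_items \<epsilon> k I ord \<or> z \<in> small_group_items \<epsilon> k I ord"
  shows "packs_within_capacity A (rounded_size \<epsilon> k I ord) m P'"
    and "conflicting A (grp I) P' \<subseteq> small_group_items \<epsilon> k I ord"
proof -
  have fin: "finite A"
    unfolding A_def by (rule finite_slot_items)
  \<comment> \<open>Every additive statistic of slot-bin pairs agrees for \<open>P'\<close> and
    \<open>P\<close>; below it is the load of a bin, then the number of slots with a given label in
    a bin.\<close>
  have sums: "(\<Sum>l\<in>A. h (v l, P' l)) = (\<Sum>l\<in>A. h (v l, P l))"
    for h :: "slot \<times> nat \<Rightarrow> 'a :: comm_monoid_add"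
    using arg_cong[OF eq, of "\<lambda>M. sum_mset (image_mset h M)"]
    by (simp add: multiset.map_comp comp_def sum_unfold_sum_mset)
  have "(\<Sum>l | l \<in> A \<and> P' l = b. rounded_size \<epsilon> k I ord l) =
      (\<Sum>l | l \<in> A \<and> P l = b. rounded_size \<epsilon> k I ord l)" for b
    using sums[of "\<lambda>(w, c). if c = b then fst w else 0"]
    by (simp add: sum_fibre_eq[OF fin] v_def slot_of_def cong: if_cong)
  moreover have "P' ` A = P ` A"
    using arg_cong[OF eq, of "\<lambda>M. snd ` set_mset M"] fin by (simp add: image_image)
  then have "\<forall>l\<in>A. P' l \<in> P ` A" by auto
  ultimately show "packs_within_capacity A (rounded_size \<epsilon> k I ord) m P'"
    using P unfolding packs_within_capacity_def by fastforce
  show "conflicting A (grp I) P' \<subseteq> small_group_items \<epsilon> k I ord"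
  proof
    fix l assume "l \<in> conflicting A (grp I) P'"
    then obtain z where lz: "l \<in> A" "z \<in> A" "l \<noteq> z" "P' l = P' z" "grp I l = grp I z"
      by (auto simp: conflicting_def conflict_def)
    show "l \<in> small_group_items \<epsilon> k I ord"
    proof (rule ccontr)
      assume "l \<notin> small_group_items \<epsilon> k I ord"
      then have large: "large_group \<epsilon> k I (grp I l)"
        using lz(1) by (auto simp: A_def slot_items_def large_group_items_def)
      \<comment> \<open>The label of a large group determines the group. Two items of
        \<open>F P'\<close> therefore force two items of \<open>F P\<close>, a conflict of
        \<open>P\<close> without small-group items.\<close>
      define F where "F p = {x \<in> A. p x = P' l \<and> snd (v x) = Large_Group (grp I l)}"
        for p :: "nat \<Rightarrow> nat"
      have F: "card (F p) = (\<Sum>x\<in>A. if p x = P' l \<and> snd (v x) = Large_Group (grp I l) then 1 else 0)"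
        for p
        using fin by (simp add: F_def sum.If_cases Int_def)
      have "card (F P') = card (F P)"
        using sums[of "\<lambda>(w, c). if c = P' l \<and> snd w = Large_Group (grp I l) then 1 else (0 :: nat)"]
        by (simp add: F)
      moreover have "card (F P') \<ge> card {l, z}"
        using lz large fin by (intro card_mono) (auto simp: F_def v_def slot_of_def label_of_def)
      ultimately have "card (F P) > Suc 0"
        using lz(3) by simp
      then obtain x y where xy: "x \<in> F P" "y \<in> F P" "x \<noteq> y"
        by (metis card_le_Suc0_iff_eq card.infinite leD less_nat_zero_code)
      then have "grp I x = grp I l" "grp I y = grp I l"
        by (auto simp: F_def v_def slot_of_def label_of_def split: if_splits)
      moreover have "x \<in> A" "y \<in> A" "conflict (grp I) P x y"
        using xy calculation by (auto simp: F_def conflict_def)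
      then have "x \<in> small_group_items \<epsilon> k I ord \<or> y \<in> small_group_items \<epsilon> k I ord"
        using confl by blast
      ultimately show False
        using large by (auto simp: small_group_items_def small_group_def)
    qed
  qed
qed

text \<open>With \<open>n\<close> packed items, filling costs \<open>2n^2+3n+2\<close> and the loop
  \<open>(n+1)(12n^2+7n+4)\<close>, since at most \<open>n\<close> items conflict; the sum is
  \<open>12n^3+21n^2+14n+6\<close>. Its coefficients depend neither on \<epsilon> nor on
  \<open>k\<close>.\<close>

lemma Swapping_run:
  assumes "0 < \<epsilon>" "\<epsilon> < 1" "gbp_instance I" "real (OPT I) > 3 / \<epsilon> ^ (k + 2)"
    and ord: "shift_orders \<epsilon> k I ord"
    and opt: "corresponds_to_optimal \<epsilon> k I ord \<zeta>"
    and ch: "swapping_choices \<epsilon> k I ord \<zeta> os ls us \<sigma>"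
  shows "\<exists>P t. Swapping \<epsilon> k I ord os ls us \<sigma> P t \<and> t \<le> poly [:6, 14, 21, 12:] (nitems I) \<and>
    feasible_packing (slot_items \<epsilon> k I ord) (rounded_size \<epsilon> k I ord) (grp I) (OPT I) P"
proof -
  let ?A = "slot_items \<epsilon> k I ord" and ?v = "slot_of \<epsilon> k I ord"
  let ?s = "rounded_size \<epsilon> k I ord" and ?m = "OPT I" and ?n = "card (slot_items \<epsilon> k I ord)"
  have fin: "finite ?A" by (rule finite_slot_items)
  obtain P where
    cap: "packs_within_capacity (rounded_items \<epsilon> k I ord) ?s ?m P" and
    confl: "\<forall>l\<in>rounded_items \<epsilon> k I ord. \<forall>z\<in>rounded_items \<epsilon> k I ord. conflict (grp I) P l z \<longrightarrow>
      l \<in> small_group_items \<epsilon> k I ord \<or> z \<in> small_group_items \<epsilon> k I ord" and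
    zeta: "\<forall>b\<in>{1..?m}. image_mset ?v (mset_set {l \<in> ?A. P l = b}) = \<zeta> b"
    using opt unfolding corresponds_to_optimal_def by blast
  have P: "packs_within_capacity ?A ?s ?m P"
    unfolding packs_within_capacity_def
  proof (intro conjI ballI)
    show "P l \<in> {1..?m}" if "l \<in> ?A" for l
      using that cap slot_items_subset(1) unfolding packs_within_capacity_def by blast
    fix b assume b: "b \<in> {1..?m}"
    \<comment> \<open>The items left out have positive rounded size, so restricting to
      \<open>?A\<close> can only lower the load.\<close>
    have "(\<Sum>l | l \<in> ?A \<and> P l = b. ?s l) \<le> (\<Sum>l | l \<in> rounded_items \<epsilon> k I ord \<and> P l = b. ?s l)"
    proof (rule sum_mono2)
      show "finite {l \<in> rounded_items \<epsilon> k I ord. P l = b}"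
        using finite_subset[OF slot_items_subset(2) finite_items] by simp
      fix l assume "l \<in> {l \<in> rounded_items \<epsilon> k I ord. P l = b} - {l \<in> ?A. P l = b}"
      then have "0 < isize I l"
        using assms(3) slot_items_subset(2) by (fastforce simp: gbp_instance_def)
      then show "0 \<le> ?s l"
        using rounded_size_ge[OF ord, of l] by linarith
    qed (use slot_items_subset(1) in blast)
    also have "\<dots> \<le> 1"
      using cap b by (simp add: packs_within_capacity_def)
    finally show "(\<Sum>l | l \<in> ?A \<and> P l = b. ?s l) \<le> 1" .
  qed
  have enum: "enumerates (ls @ us) ?A"
    using ch enumerates_append unfolding swapping_choices_def by blast
  then have mset: "mset (ls @ us) = mset_set ?A" and len: "length (ls @ us) = ?n"
    by (metis enumerates_def mset_set_set, metis enumerates_def distinct_card)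
  \<comment> \<open>The slots offered by \<open>\<zeta>\<close> are those that the items occupy in
    the optimal packing \<open>P\<close>, so each kind of slot is available exactly as often as it
    is needed.\<close>
  have "mset os = (\<Sum>b\<in>{1..?m}. image_mset (\<lambda>w. (w, b)) (image_mset ?v (mset_set {l \<in> ?A. P l = b})))"
    using ch zeta unfolding swapping_choices_def lists_slots_def by simp
  also have "\<dots> = image_mset (\<lambda>l. (?v l, P l)) (mset_set ?A)"
    by (rule sum_image_mset_fibres[OF fin]) (use P in \<open>auto simp: packs_within_capacity_def\<close>)
  finally have os: "mset os = image_mset (\<lambda>l. (?v l, P l)) (mset_set ?A)" .
  have "image_mset ?v (mset (ls @ us)) = image_mset fst (mset os)"
    unfolding os mset by (simp add: multiset.map_comp comp_def)
  then obtain os1 P1 t1 os2 P2 t2 where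
    fill: "fill ?v ls os (\<lambda>_. 0) os1 P1 t1" "fill ?v us os1 P1 os2 P2 t2" and
    t12: "t1 + t2 \<le> ?n * (2 * ?n + 3) + 2" and
    P2: "mset os = image_mset (\<lambda>l. (?v l, P2 l)) (mset_set ?A)"
    using fill_both_succeeds[of ls us ?v os "\<lambda>_. 0"] enum
    unfolding enumerates_def len mset by blast
  have confl': "\<forall>l\<in>?A. \<forall>z\<in>?A. conflict (grp I) P l z \<longrightarrow>
      l \<in> small_group_items \<epsilon> k I ord \<or> z \<in> small_group_items \<epsilon> k I ord"
    using confl slot_items_subset(1) by blast
  note start = same_slots_transfer[OF trans[OF P2[symmetric] os] P confl']
  have orders: "enumerates (fst (\<sigma> i)) ?A" "enumerates (snd (\<sigma> i)) ?A" for i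
    using ch by (auto simp: swapping_choices_def)
  have "\<exists>P' t. swap_loop ?s (grp I) \<sigma> 0 P2 P' t \<and> feasible_packing ?A ?s (grp I) ?m P' \<and>
      t \<le> (card (conflicting ?A (grp I) P2) + 1) * ((12 * ?n + 7) * ?n + 4)"
    \<comment> \<open>The set \<open>S\<close> becomes \<open>small_group_items\<close>, through the
      second fact of \<open>start\<close>.\<close>
    by (rule swap_loop_terminates[OF fin orders _ start]) (rule ex_good_swap_rounded[OF assms(1-5)])
  then obtain P' t3 where
    loop: "swap_loop ?s (grp I) \<sigma> 0 P2 P' t3" "feasible_packing ?A ?s (grp I) ?m P'" and
    t3: "t3 \<le> (card (conflicting ?A (grp I) P2) + 1) * ((12 * ?n + 7) * ?n + 4)"
    by blast
  let ?p = "[:6, 14, 21, 12:] :: nat poly"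
  have "card (conflicting ?A (grp I) P2) \<le> ?n"
    by (rule card_mono[OF fin]) (auto simp: conflicting_def)
  then have "t3 \<le> (?n + 1) * ((12 * ?n + 7) * ?n + 4)"
    using t3 by (meson add_le_mono1 le_trans mult_le_mono1)
  then have "t1 + t2 + t3 \<le> poly ?p ?n"
    using t12 by (simp add: algebra_simps)
  also have "\<dots> \<le> poly ?p (nitems I)"
  proof -
    have "?n \<le> card (items I)"
      using slot_items_subset by (intro card_mono finite_items) blast
    then have "?n \<le> nitems I"
      by (simp add: items_def)
    then show ?thesis
      by (simp add: add_mono mult_mono)
  qed
  finally show ?thesis
    using fill loop unfolding Swapping_def by blast
qed

theorem theorem3p7:
  fixes \<epsilon> :: real
  assumes "0 < \<epsilon>" and "\<epsilon> < 1"
  shows "\<exists>p :: nat poly. \<forall>(I :: gbp) (k :: nat) (ord :: label \<Rightarrow> nat list) (\<zeta> :: nat \<Rightarrow> slot multiset)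
            os ls us \<sigma>.
      gbp_instance I \<longrightarrow> admissible_k \<epsilon> I k \<longrightarrow> real (OPT I) > 3 / \<epsilon> ^ (k + 2) \<longrightarrow>
      shift_orders \<epsilon> k I ord \<longrightarrow> corresponds_to_optimal \<epsilon> k I ord \<zeta> \<longrightarrow>
      swapping_choices \<epsilon> k I ord \<zeta> os ls us \<sigma> \<longrightarrow>
      (\<exists>P t. Swapping \<epsilon> k I ord os ls us \<sigma> P t \<and> t \<le> poly p (nitems I) \<and>
             feasible_packing (slot_items \<epsilon> k I ord) (rounded_size \<epsilon> k I ord) (grp I) (OPT I) P)"
  using Swapping_run[OF assms] by blast

end
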